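(* Let $\mathcal{X}$ be a Banach space and let $B, C\in\mathcal{L}(\mathcal{X})$ be two regular operators. For $A\in\mathcal{L}(\mathcal{X})$ the following statements are equivalent. (i) $A$ is $(B,C)$-invertible. (ii) There exists $X\in\mathcal{L}(\mathcal{X})$ such that $X=XAX$, $\mathcal{R}(X)=\mathcal{R}(B)$ and $\mathcal{N}(X)=\mathcal{N}(C)$. (iii) The outer inverse $A^{(2)}_{\mathcal{R}(B),\mathcal{N}(C)}$ exists. (iv) The restriction $A|_{\mathcal{R}(B)}^{\mathcal{R}(AB)}\colon\mathcal{R}(B)\to\mathcal{R}(AB)$ is invertible and $\mathcal{R}(AB)\oplus\mathcal{N}(C)=\mathcal{X}$. Furthermore, in this case $A^{-(B,C)}=X=A^{(2)}_{\mathcal{R}(B),\mathcal{N}(C)}$.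
   Context: $\mathcal{L}(\mathcal{X})$ is the Banach algebra of bounded linear operators on the Banach space $\mathcal{X}$; $\mathcal{R}(T)$ and $\mathcal{N}(T)$ are the range and null space of $T$. An element $x$ of a unital algebra $\mathcal{A}$ is regular if there is $y\in\mathcal{A}$ with $x=xyx$. For $b,c\in\mathcal{A}$, an element $a\in\mathcal{A}$ is $(b,c)$-invertible if there exists $y\in\mathcal{A}$ such that $y\in (b\mathcal{A}y)\cap(y\mathcal{A}c)$, $b=yab$ and $c=cay$; such $y$ is unique when it exists and is denoted $a^{-(b,c)}$ (here $\mathcal{A}=\mathcal{L}(\mathcal{X})$). For Banach spaces $\mathcal{X},\mathcal{Y}$, $A\in\mathcal{L}(\mathcal{X},\mathcal{Y})$ and closed subspaces $\mathcal{T}\subseteq\mathcal{X}$, $\mathcal{S}\subseteq\mathcal{Y}$, the outer inverse $A^{(2)}_{\mathcal{T},\mathcal{S}}$ is the (necessarily unique, if it exists) operator $Y\in\mathcal{L}(\mathcal{Y},\mathcal{X})$ with $YAY=Y$, $\mathcal{R}(Y)=\mathcal{T}$ and $\mathcal{N}(Y)=\mathcal{S}$. *)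

theory Defs
  imports "HOL-Analysis.Analysis"
begin

text \<open>
  The class \<open>banach\<close> provides the norm, its completeness and the real structure; the scalar
  multiplication \<open>s\<close> says over which field the space is considered. The type \<open>'k\<close> ranges over
  \<open>real_normed_field\<close>, whose instances include \<open>real\<close> (with \<open>s = scaleR\<close>) and \<open>complex\<close>, so that
  real and complex Banach spaces are both covered.
\<close>

locale normed_space_over = vector_space s
  for s :: "'k::real_normed_field \<Rightarrow> 'a::real_normed_vector \<Rightarrow> 'a" +
  assumes norm_scale: "norm (s c x) = norm c * norm x"
    and scale_of_real: "s (of_real r) x = r *\<^sub>R x"

text \<open>
  Elements of \<open>'a \<Rightarrow>\<^sub>L 'b\<close> are bounded and real-linear; the bounded operators of the Banach
  spaces over \<open>'k\<close> are those which are also \<open>'k\<close>-homogeneous. For \<open>'k = real\<close> this is everything.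
\<close>

definition bounded_operators ::
  "('k \<Rightarrow> 'a \<Rightarrow> 'a) \<Rightarrow> ('k \<Rightarrow> 'b \<Rightarrow> 'b) \<Rightarrow> ('a::real_normed_vector \<Rightarrow>\<^sub>L 'b::real_normed_vector) set"
  where "bounded_operators s t =
    {T. \<forall>c x. blinfun_apply T (s c x) = t c (blinfun_apply T x)}"

abbreviation operator_algebra ::
  "('k \<Rightarrow> 'a \<Rightarrow> 'a) \<Rightarrow> ('a::real_normed_vector \<Rightarrow>\<^sub>L 'a) set"
  where "operator_algebra s \<equiv> bounded_operators s s"

lemma normed_space_over_real: "normed_space_over (scaleR :: real \<Rightarrow> 'a::real_normed_vector \<Rightarrow> 'a)"
  by unfold_locales (simp_all add: scaleR_add_right scaleR_add_left)

lemma normed_space_over_complex: "normed_space_over ((*) :: complex \<Rightarrow> complex \<Rightarrow> complex)"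
  by unfold_locales (simp_all add: algebra_simps norm_mult scaleR_conv_of_real)

lemma operator_algebra_real:
  "operator_algebra (scaleR :: real \<Rightarrow> 'a::real_normed_vector \<Rightarrow> 'a) = UNIV"
  by (auto simp: bounded_operators_def blinfun.scaleR_right)

definition op_range :: "('a::real_normed_vector \<Rightarrow>\<^sub>L 'b::real_normed_vector) \<Rightarrow> 'b set"
  where "op_range T = range (blinfun_apply T)"

definition null_space :: "('a::real_normed_vector \<Rightarrow>\<^sub>L 'b::real_normed_vector) \<Rightarrow> 'a set"
  where "null_space T = {x. blinfun_apply T x = 0}"

definition regular_in ::
  "('a::real_normed_vector \<Rightarrow>\<^sub>L 'a) set \<Rightarrow> ('a \<Rightarrow>\<^sub>L 'a) \<Rightarrow> bool"
  where "regular_in \<A> x \<longleftrightarrow> (\<exists>y\<in>\<A>. x = x o\<^sub>L y o\<^sub>L x)"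

definition is_bc_inverse_in ::
  "('a::real_normed_vector \<Rightarrow>\<^sub>L 'a) set \<Rightarrow> ('a \<Rightarrow>\<^sub>L 'a) \<Rightarrow> ('a \<Rightarrow>\<^sub>L 'a) \<Rightarrow> ('a \<Rightarrow>\<^sub>L 'a)
    \<Rightarrow> ('a \<Rightarrow>\<^sub>L 'a) \<Rightarrow> bool"
  where "is_bc_inverse_in \<A> b c a y \<longleftrightarrow>
    y \<in> \<A> \<and>
    y \<in> {b o\<^sub>L u o\<^sub>L y | u. u \<in> \<A>} \<inter> {y o\<^sub>L u o\<^sub>L c | u. u \<in> \<A>} \<and>
    b = y o\<^sub>L a o\<^sub>L b \<and> c = c o\<^sub>L a o\<^sub>L y"

definition bc_invertible_in ::
  "('a::real_normed_vector \<Rightarrow>\<^sub>L 'a) set \<Rightarrow> ('a \<Rightarrow>\<^sub>L 'a) \<Rightarrow> ('a \<Rightarrow>\<^sub>L 'a) \<Rightarrow> ('a \<Rightarrow>\<^sub>L 'a) \<Rightarrow> bool"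
  where "bc_invertible_in \<A> b c a \<longleftrightarrow> (\<exists>y. is_bc_inverse_in \<A> b c a y)"

definition bc_inverse_in ::
  "('a::real_normed_vector \<Rightarrow>\<^sub>L 'a) set \<Rightarrow> ('a \<Rightarrow>\<^sub>L 'a) \<Rightarrow> ('a \<Rightarrow>\<^sub>L 'a) \<Rightarrow> ('a \<Rightarrow>\<^sub>L 'a)
    \<Rightarrow> ('a \<Rightarrow>\<^sub>L 'a)"
  where "bc_inverse_in \<A> b c a = (THE y. is_bc_inverse_in \<A> b c a y)"

lemma is_bc_inverse_in_unique:
  assumes "is_bc_inverse_in \<A> b c a y" and "is_bc_inverse_in \<A> b c a z"
  shows "y = z"
proof -
  have assoc: "(p o\<^sub>L q) o\<^sub>L r = p o\<^sub>L (q o\<^sub>L r)" for p q r :: "'a \<Rightarrow>\<^sub>L 'a"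
    by (rule blinfun_eqI) simp
  obtain u v where u: "z = b o\<^sub>L u o\<^sub>L z" and v: "y = y o\<^sub>L v o\<^sub>L c"
    using assms unfolding is_bc_inverse_in_def by blast
  have b: "b = y o\<^sub>L a o\<^sub>L b" and c: "c = c o\<^sub>L a o\<^sub>L z"
    using assms unfolding is_bc_inverse_in_def by blast+
  have "y = y o\<^sub>L a o\<^sub>L z"
    using v c by (metis assoc)
  moreover have "z = y o\<^sub>L a o\<^sub>L z"
    using u b by (metis assoc)
  ultimately show ?thesis by simp
qed

definition is_outer_inverse ::
  "('k::field \<Rightarrow> 'a \<Rightarrow> 'a) \<Rightarrow> ('k \<Rightarrow> 'b \<Rightarrow> 'b) \<Rightarrow> ('a::real_normed_vector \<Rightarrow>\<^sub>L 'b::real_normed_vector)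
    \<Rightarrow> 'a set \<Rightarrow> 'b set \<Rightarrow> ('b \<Rightarrow>\<^sub>L 'a) \<Rightarrow> bool"
  where "is_outer_inverse s t A T S Y \<longleftrightarrow>
    module.subspace s T \<and> closed T \<and> module.subspace t S \<and> closed S \<and>
    Y \<in> bounded_operators t s \<and>
    Y o\<^sub>L A o\<^sub>L Y = Y \<and> op_range Y = T \<and> null_space Y = S"

definition outer_inverse_exists ::
  "('k::field \<Rightarrow> 'a \<Rightarrow> 'a) \<Rightarrow> ('k \<Rightarrow> 'b \<Rightarrow> 'b) \<Rightarrow> ('a::real_normed_vector \<Rightarrow>\<^sub>L 'b::real_normed_vector)
    \<Rightarrow> 'a set \<Rightarrow> 'b set \<Rightarrow> bool"
  where "outer_inverse_exists s t A T S \<longleftrightarrow> (\<exists>Y. is_outer_inverse s t A T S Y)"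

definition outer_inverse ::
  "('k::field \<Rightarrow> 'a \<Rightarrow> 'a) \<Rightarrow> ('k \<Rightarrow> 'b \<Rightarrow> 'b) \<Rightarrow> ('a::real_normed_vector \<Rightarrow>\<^sub>L 'b::real_normed_vector)
    \<Rightarrow> 'a set \<Rightarrow> 'b set \<Rightarrow> ('b \<Rightarrow>\<^sub>L 'a)"
  where "outer_inverse s t A T S = (THE Y. is_outer_inverse s t A T S Y)"

lemma is_outer_inverse_unique:
  assumes "is_outer_inverse s t A T S Y" and "is_outer_inverse s t A T S Z"
  shows "Y = Z"
proof (rule blinfun_eqI)
  fix x
  have Y: "Y o\<^sub>L A o\<^sub>L Y = Y" and Z: "Z o\<^sub>L A o\<^sub>L Z = Z"
    and R: "op_range Y = op_range Z" and N: "null_space Y = null_space Z"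
    using assms by (auto simp: is_outer_inverse_def)
  have "Z x \<in> op_range Y"
    unfolding R by (simp add: op_range_def)
  then obtain w where w: "Z x = Y w"
    by (auto simp: op_range_def)
  have "Y (A (Z x)) = Z x"
    unfolding w using Y by (metis blinfun_apply_blinfun_compose)
  moreover have "Z (A (Z x)) = Z x"
    using Z by (metis blinfun_apply_blinfun_compose)
  then have "x - A (Z x) \<in> null_space Z"
    by (simp add: null_space_def blinfun.diff_right)
  then have "Y (x - A (Z x)) = 0"
    using N by (auto simp: null_space_def)
  ultimately show "Y x = Z x"
    by (simp add: blinfun.diff_right)
qed

text \<open>
  Invertibility of the restriction \<open>A : M \<rightarrow> N\<close> as an operator between normed spaces: it has a
  two-sided inverse \<open>N \<rightarrow> M\<close> that is linear over \<open>'k\<close> and bounded. The values of \<open>G\<close> outside \<open>N\<close>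
  are irrelevant.
\<close>

definition restriction_invertible ::
  "('k \<Rightarrow> 'a \<Rightarrow> 'a) \<Rightarrow> ('k \<Rightarrow> 'b \<Rightarrow> 'b) \<Rightarrow> ('a::real_normed_vector \<Rightarrow>\<^sub>L 'b::real_normed_vector)
    \<Rightarrow> 'a set \<Rightarrow> 'b set \<Rightarrow> bool"
  where "restriction_invertible s t A M N \<longleftrightarrow>
    blinfun_apply A ` M \<subseteq> N \<and>
    (\<exists>G. G ` N \<subseteq> M \<and>
      (\<forall>x\<in>N. \<forall>y\<in>N. G (x + y) = G x + G y) \<and>
      (\<forall>c. \<forall>y\<in>N. G (t c y) = s c (G y)) \<and>
      (\<exists>K. \<forall>y\<in>N. norm (G y) \<le> K * norm y) \<and>
      (\<forall>x\<in>M. G (blinfun_apply A x) = x) \<and>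
      (\<forall>y\<in>N. blinfun_apply A (G y) = y))"

definition direct_sum_is_UNIV :: "'a::ab_group_add set \<Rightarrow> 'a set \<Rightarrow> bool"
  where "direct_sum_is_UNIV M N \<longleftrightarrow> {m + n | m n. m \<in> M \<and> n \<in> N} = UNIV \<and> M \<inter> N = {0}"

end

theory Submission
  imports Defs
begin

text \<open>
  For regular \<open>B\<close> and \<open>C\<close> the conditions defining a \<open>(B, C)\<close>-inverse \<open>X\<close> say exactly that \<open>X\<close> is an
  outer inverse of \<open>A\<close> with the range of \<open>B\<close> and the null space of \<open>C\<close>: if \<open>B = B b B\<close>, then \<open>B b\<close>
  is a projection onto the range of \<open>B\<close>, which gives \<open>X = B b X\<close>, and similarly for \<open>C\<close>.
  The outer inverse yields (iv) because \<open>A X\<close> is a projection onto the range of \<open>A B\<close> along the null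
  space of \<open>C\<close>. Conversely, under (iv) the candidate is the inverse of the restriction composed with
  the projection along the null space of \<open>C\<close>; that projection is bounded by the open mapping theorem,
  applied to \<open>(x, z) \<mapsto> A B x + (1 - c C) z\<close>, where \<open>C = C c C\<close>.
\<close>

section \<open>Open mapping theorem: norm-controlled preimages under a surjection\<close>

text \<open>By Baire, the closure of the image of some ball contains a ball; differences move that
  ball to the origin, and scaling then reaches every \<open>y\<close>.\<close>

lemma surj_blinfun_approx_preimage:
  fixes T :: "'a::real_normed_vector \<Rightarrow>\<^sub>L 'b::banach"
  assumes "surj T"
  shows "\<exists>M\<ge>0. \<forall>y. \<exists>x. norm x \<le> M * norm y \<and> norm (y - T x) \<le> norm y / 2"
proof -
  define F where "F n = closure (T ` cball 0 (real n))" for n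
  have cover: "(\<Union>n. F n) = UNIV"
  proof -
    have "y \<in> (\<Union>n. F n)" for y
    proof -
      obtain x where "y = T x" using assms by (metis surjD)
      moreover obtain n where "norm x \<le> real n" using real_arch_simple by blast
      ultimately have "y \<in> T ` cball 0 (real n)" by auto
      then have "y \<in> F n"
        unfolding F_def by (rule subsetD[OF closure_subset])
      then show ?thesis by blast
    qed
    then show ?thesis by blast
  qed
  have "\<exists>n. interior (F n) \<noteq> {}"
  proof (rule ccontr)
    assume "\<not> ?thesis"
    then have "euclidean interior_of \<Union>(range F) = {}"
      by (intro Baire_category_alt) (auto simp: completely_metrizable_space_euclidean F_def)
    then show False using cover by simp
  qed
  then obtain n y0 where "y0 \<in> interior (F n)" by blast
  then obtain r where r: "r > 0" "ball y0 r \<subseteq> F n"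
    using mem_interior by blast
  \<comment> \<open>Approximate preimages of \<open>y0\<close> and \<open>y0 + z\<close> are
    subtracted, which cancels the centre and doubles the norm bound.\<close>
  have diff: "\<exists>x. norm x \<le> 2 * real n \<and> norm (z - T x) < e" if z: "norm z < r" and e: "e > 0" for z e
  proof -
    have "y0 \<in> F n" "y0 + z \<in> F n"
      using r z by (auto simp: dist_norm)
    then obtain u v where u: "norm u \<le> real n" "dist (T u) y0 < e / 2"
      and v: "norm v \<le> real n" "dist (T v) (y0 + z) < e / 2"
      using e unfolding F_def closure_approachable by (auto dest!: spec[of _ "e / 2"])
    have "norm (v - u) \<le> 2 * real n"
      using norm_triangle_ineq4[of v u] u v by linarith
    moreover have eq: "z - T (v - u) = (T u - y0) - (T v - (y0 + z))"
      by (simp add: blinfun.diff_right)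
    have "norm (z - T (v - u)) < e"
      unfolding eq using norm_triangle_ineq4[of "T u - y0" "T v - (y0 + z)"] u(2) v(2)
      unfolding dist_norm by linarith
    ultimately show ?thesis by blast
  qed
  have "\<exists>x. norm x \<le> (4 * real n / r) * norm y \<and> norm (y - T x) \<le> norm y / 2" for y
  proof (cases "y = 0")
    case True
    then show ?thesis by (intro exI[of _ 0]) simp
  next
    case False
    \<comment> \<open>This brings \<open>y\<close> to norm \<open>r / 2\<close>, inside the ball; an
      error of \<open>r / 4\<close> there becomes \<open>norm y / 2\<close> after scaling
      back.\<close>
    define k where "k = 2 * norm y / r"
    have k: "k > 0" using False r by (simp add: k_def)
    have "norm (y /\<^sub>R k) < r" using False r by (simp add: k_def)
    moreover have "r / 4 > 0" using r by simp
    ultimately obtain x where x: "norm x \<le> 2 * real n" "norm (y /\<^sub>R k - T x) < r / 4"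
      using diff by meson
    have "norm (k *\<^sub>R x) \<le> k * (2 * real n)"
      using x k by simp
    moreover have "y - T (k *\<^sub>R x) = k *\<^sub>R (y /\<^sub>R k - T x)"
      using k by (simp add: blinfun.scaleR_right scaleR_diff_right)
    then have "norm (y - T (k *\<^sub>R x)) \<le> k * (r / 4)"
      using x k by simp
    ultimately show ?thesis
      using r by (intro exI[of _ "k *\<^sub>R x"]) (simp add: k_def field_simps)
  qed
  moreover have "4 * real n / r \<ge> 0" using r by simp
  ultimately show ?thesis by blast
qed

text \<open>Approximation is iterated on the remainder, which at least halves each time. The
  corrections are dominated by a geometric series, whence the factor 2, and sum to an exact preimage
  because the domain is complete.\<close>

lemma surj_blinfun_bounded_preimage:
  fixes T :: "'a::banach \<Rightarrow>\<^sub>L 'b::banach"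
  assumes "surj T"
  shows "\<exists>K\<ge>0. \<forall>y. \<exists>x. T x = y \<and> norm x \<le> K * norm y"
proof -
  obtain M g where M: "M \<ge> 0" and g: "\<And>y. norm (g y) \<le> M * norm y"
    and step: "\<And>y. norm (y - T (g y)) \<le> norm y / 2"
    using surj_blinfun_approx_preimage[OF assms] by metis
  have "\<exists>x. T x = y \<and> norm x \<le> (M * 2) * norm y" for y
  proof -
    define r where "r n = ((\<lambda>y. y - T (g y)) ^^ n) y" for n
    have r_Suc: "r (Suc n) = r n - T (g (r n))" for n by (simp add: r_def)
    have r_le: "norm (r n) \<le> norm y * (1 / 2) ^ n" for n
    proof (induction n)
      case (Suc n)
      then show ?case using step[of "r n"] by (simp add: r_Suc)
    qed (simp add: r_def)
    have g_le: "norm (g (r n)) \<le> M * norm y * (1 / 2) ^ n" for n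
      using g[of "r n"] mult_left_mono[OF r_le[of n] M] by (simp add: mult.assoc)
    have geo: "(\<lambda>n. M * norm y * (1 / 2) ^ n) sums (M * norm y * 2)"
      using sums_mult[OF geometric_sums[of "1 / 2 :: real"], of "M * norm y"] by simp
    have summable: "summable (\<lambda>n. g (r n))"
      by (rule summable_comparison_test'[OF sums_summable[OF geo] g_le])
    have "norm (\<Sum>n. g (r n)) \<le> M * norm y * 2"
      using norm_suminf_le[OF g_le sums_summable[OF geo]] sums_unique[OF geo] by linarith
    moreover have "T (\<Sum>n. g (r n)) = y"
    proof -
      have "(\<lambda>n. norm y * (1 / 2) ^ n) \<longlonglongrightarrow> norm y * 0"
        by (intro tendsto_mult_left LIMSEQ_power_zero) simp
      then have "r \<longlonglongrightarrow> 0"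
        using r_le by (intro Lim_null_comparison[of r "\<lambda>n. norm y * (1 / 2) ^ n"]) auto
      \<comment> \<open>Each difference of remainders is the image of one correction, and
        \<open>r 0\<close> is \<open>y\<close>.\<close>
      then have "(\<lambda>n. r n - r (Suc n)) sums (r 0 - 0)"
        by (rule telescope_sums')
      then have "(\<lambda>n. T (g (r n))) sums y"
        by (simp add: r_Suc) (simp add: r_def)
      moreover have "(\<lambda>n. T (g (r n))) sums T (\<Sum>n. g (r n))"
        using summable by (intro bounded_linear.sums[OF blinfun.bounded_linear_right] summable_sums)
      ultimately show ?thesis by (simp add: sums_iff)
    qed
    ultimately show ?thesis by (auto simp: algebra_simps)
  qed
  moreover have "M * 2 \<ge> 0" using M by simp
  ultimately show ?thesis by blast
qed

section \<open>(B,C)-inverses as outer inverses with prescribed range and null space\<close>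

lemma is_bc_inverse_in_iff_range_null_space:
  assumes "regular_in \<A> B" and "regular_in \<A> C"
  shows "is_bc_inverse_in \<A> B C A X \<longleftrightarrow>
    X \<in> \<A> \<and> X = X o\<^sub>L A o\<^sub>L X \<and> op_range X = op_range B \<and> null_space X = null_space C"
    (is "?bc \<longleftrightarrow> ?out")
proof
  assume bc: ?bc
  then obtain u v where X: "X \<in> \<A>" and u: "X = B o\<^sub>L u o\<^sub>L X" and v: "X = X o\<^sub>L v o\<^sub>L C"
    and B: "B = X o\<^sub>L A o\<^sub>L B" and C: "C = C o\<^sub>L A o\<^sub>L X"
    unfolding is_bc_inverse_in_def by blast
  have u: "X x = B (u (X x))" and v: "X x = X (v (C x))"
    and B: "B x = X (A (B x))" and C: "C x = C (A (X x))" for x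
    by (metis u v B C blinfun_apply_blinfun_compose)+
  have "X = X o\<^sub>L A o\<^sub>L X"
    by (rule blinfun_eqI) (metis blinfun_apply_blinfun_compose u B)
  moreover have "op_range X = op_range B"
    unfolding op_range_def using u B by (metis rangeI subsetI image_subsetI subset_antisym)
  moreover have "null_space X = null_space C"
    unfolding null_space_def using v C by (metis blinfun.zero_right)
  ultimately show ?out using X by blast
next
  assume out: ?out
  obtain b c where b: "b \<in> \<A>" "B = B o\<^sub>L b o\<^sub>L B" and c: "c \<in> \<A>" "C = C o\<^sub>L c o\<^sub>L C"
    using assms unfolding regular_in_def by blast
  have BbB: "B x = B (b (B x))" and CcC: "C x = C (c (C x))" and XAX: "X x = X (A (X x))" for x
    by (metis b c out blinfun_apply_blinfun_compose)+
  have R: "\<exists>w. X x = B w" "\<exists>w. B x = X w" for x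
    using out unfolding op_range_def by (metis rangeE rangeI)+
  have N: "X x = 0 \<longleftrightarrow> C x = 0" for x
    using out unfolding null_space_def by blast
  \<comment> \<open>Equal null spaces mean that \<open>X\<close> and \<open>C\<close> identify the
    same pairs of points. This carries \<open>C c C = C\<close> over to \<open>X\<close>, and
    \<open>X A X = X\<close> over to \<open>C\<close>.\<close>
  have kernels: "X x = X y \<longleftrightarrow> C x = C y" for x y
    using N[of "x - y"] by (simp add: blinfun.diff_right)
  have "X = B o\<^sub>L b o\<^sub>L X"
    by (rule blinfun_eqI) (metis blinfun_apply_blinfun_compose R(1) BbB)
  moreover have "X = X o\<^sub>L c o\<^sub>L C"
    by (rule blinfun_eqI) (metis blinfun_apply_blinfun_compose kernels CcC)
  moreover have "B = X o\<^sub>L A o\<^sub>L B"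
    by (rule blinfun_eqI) (metis blinfun_apply_blinfun_compose R(2) XAX)
  moreover have "C = C o\<^sub>L A o\<^sub>L X"
    by (rule blinfun_eqI) (metis blinfun_apply_blinfun_compose kernels XAX)
  ultimately show ?bc
    unfolding is_bc_inverse_in_def using b(1) c(1) out by blast
qed

lemma closed_null_space: "closed (null_space T)"
  unfolding null_space_def
  by (intro closed_Collect_eq linear_continuous_on blinfun.bounded_linear_right continuous_on_const)

text \<open>With an inner inverse \<open>b\<close>, the range of \<open>B\<close> is the set of
  fixed points of \<open>B b\<close>, hence a null space.\<close>

lemma closed_op_range_of_regular:
  assumes "regular_in \<A> B"
  shows "closed (op_range B)"
proof -
  obtain b where "B = B o\<^sub>L b o\<^sub>L B"
    using assms unfolding regular_in_def by blast
  then have "B x = B (b (B x))" for x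
    by (metis blinfun_apply_blinfun_compose)
  then have "op_range B = null_space (id_blinfun - (B o\<^sub>L b))"
    unfolding op_range_def null_space_def
    by (auto simp: blinfun.diff_left)
  then show ?thesis by (simp add: closed_null_space)
qed

context normed_space_over
begin

lemma subspace_op_range:
  assumes "T \<in> operator_algebra s"
  shows "subspace (op_range T)"
proof -
  have hom: "s c (T x) = T (s c x)" for c x
    using assms by (simp add: bounded_operators_def)
  show ?thesis
    unfolding subspace_def op_range_def
    by (auto simp: hom simp flip: blinfun.add_right intro: range_eqI[of _ _ 0])
qed

lemma subspace_null_space:
  assumes "T \<in> operator_algebra s"
  shows "subspace (null_space T)"
  using assms unfolding subspace_def null_space_def bounded_operators_def
  by (auto simp: blinfun.add_right)

text \<open>The point is that the prescribed spaces are closed subspaces; for the range of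
  \<open>B\<close>, closedness comes from regularity.\<close>

lemma is_outer_inverse_range_null_space_iff:
  assumes "B \<in> operator_algebra s" "C \<in> operator_algebra s" "regular_in (operator_algebra s) B"
  shows "is_outer_inverse s s A (op_range B) (null_space C) X \<longleftrightarrow>
    X \<in> operator_algebra s \<and> X = X o\<^sub>L A o\<^sub>L X \<and>
    op_range X = op_range B \<and> null_space X = null_space C"
  unfolding is_outer_inverse_def
  using subspace_op_range[OF assms(1)] subspace_null_space[OF assms(2)]
    closed_op_range_of_regular[OF assms(3)] closed_null_space[of C]
  by auto

end

section \<open>From an outer inverse to the restriction and the direct sum\<close>

text \<open>\<open>X\<close> itself inverts the restriction, since \<open>X A\<close> is the
  identity on the range of \<open>X\<close> and \<open>A X\<close> is the identity on its own range.
  The idempotent \<open>A X\<close> has the null space of \<open>X\<close>, which gives the direct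
  sum.\<close>

lemma restriction_invertible_direct_sum_of_outer_inverse:
  assumes "X \<in> bounded_operators t s" and XAX: "X = X o\<^sub>L A o\<^sub>L X"
    and R: "op_range X = op_range B" and N: "null_space X = null_space C"
  shows "restriction_invertible s t A (op_range B) (op_range (A o\<^sub>L B)) \<and>
    direct_sum_is_UNIV (op_range (A o\<^sub>L B)) (null_space C)"
proof
  have XAX: "X (A (X x)) = X x" for x
    by (metis XAX blinfun_apply_blinfun_compose)
  have AB: "op_range (A o\<^sub>L B) = range (\<lambda>x. A (X x))"
    using R unfolding op_range_def by (auto simp: image_iff) (metis rangeE rangeI)+
  have "norm (X y) \<le> norm X * norm y" for y
    by (rule norm_blinfun)
  then show "restriction_invertible s t A (op_range B) (op_range (A o\<^sub>L B))"
    unfolding restriction_invertible_def AB R[symmetric]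
    using assms(1) XAX
    by (intro conjI exI[of _ "blinfun_apply X"] exI[of _ "norm X"])
      (auto simp: op_range_def bounded_operators_def blinfun.add_right)
  have "y \<in> {m + n |m n. m \<in> range (\<lambda>x. A (X x)) \<and> n \<in> null_space X}" for y
  proof -
    have "y = A (X y) + (y - A (X y))" "y - A (X y) \<in> null_space X"
      by (simp_all add: null_space_def blinfun.diff_right XAX)
    then show ?thesis by blast
  qed
  moreover have "range (\<lambda>x. A (X x)) \<inter> null_space X = {0}"
    by (auto simp: null_space_def XAX intro: range_eqI[of _ _ 0])
  ultimately show "direct_sum_is_UNIV (op_range (A o\<^sub>L B)) (null_space C)"
    unfolding direct_sum_is_UNIV_def AB N[symmetric] by blast
qed

section \<open>From the restriction and the direct sum to an outer inverse\<close>

lemma bounded_projection_of_direct_sum: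
  fixes S :: "'a::banach \<Rightarrow>\<^sub>L 'a" and C :: "'a \<Rightarrow>\<^sub>L 'a"
  assumes sum: "direct_sum_is_UNIV (op_range S) (null_space C)" and C: "C = C o\<^sub>L c o\<^sub>L C"
  shows "\<exists>P :: 'a \<Rightarrow>\<^sub>L 'a. \<forall>w. P w \<in> op_range S \<and> w - P w \<in> null_space C"
proof -
  have CcC: "C (c (C x)) = C x" for x
    by (metis C blinfun_apply_blinfun_compose)
  have decomp: "\<exists>x. C (w - S x) = 0" for w
  proof -
    have "w \<in> {m + n |m n. m \<in> op_range S \<and> n \<in> null_space C}"
      using sum unfolding direct_sum_is_UNIV_def by simp
    then obtain x n where "w = S x + n" "C n = 0"
      by (auto simp: op_range_def null_space_def)
    then have "C (w - S x) = 0" by simp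
    then show ?thesis ..
  qed
  then obtain g where g: "\<And>w. C (w - S (g w)) = 0" by metis
  \<comment> \<open>The choice \<open>g\<close> need not be linear, but \<open>S (g w)\<close> is
    the unique component of \<open>w\<close> in the range of \<open>S\<close>; linearity will follow
    from this.\<close>
  have unique: "S (g w) = S x" if "C (w - S x) = 0" for w x
  proof -
    have "C (S (x - g w)) = 0"
      using that g[of w] by (simp add: blinfun.diff_right)
    then have "S (x - g w) \<in> op_range S \<inter> null_space C"
      by (simp add: op_range_def null_space_def)
    then have "S (x - g w) = 0"
      using sum unfolding direct_sum_is_UNIV_def by blast
    then show ?thesis by (simp add: blinfun.diff_right)
  qed
  define T where "T = Blinfun (\<lambda>p. S (fst p) + (snd p - c (C (snd p))))"
  have T: "T p = S (fst p) + (snd p - c (C (snd p)))" for p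
    unfolding T_def by (subst bounded_linear_Blinfun_apply) (intro bounded_linear_intros, rule refl)
  \<comment> \<open>The component \<open>w - S (g w)\<close> lies in the null space of
    \<open>C\<close>, so \<open>1 - c C\<close> fixes it.\<close>
  have "\<exists>p. w = T p" for w
    by (intro exI[of _ "(g w, w - S (g w))"]) (simp add: T g)
  then obtain K where K: "\<And>w. \<exists>p. T p = w \<and> norm p \<le> K * norm w"
    using surj_blinfun_bounded_preimage[of T] unfolding surj_def by metis
  have "bounded_linear (\<lambda>w. S (g w))"
  proof (rule bounded_linear_intro)
    fix v w r
    have "S (g (v + w)) = S (g v + g w)"
      using g[of v] g[of w] by (intro unique) (simp add: blinfun.diff_right blinfun.add_right)
    then show "S (g (v + w)) = S (g v) + S (g w)"
      by (simp add: blinfun.add_right)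
    have "S (g (r *\<^sub>R v)) = S (r *\<^sub>R g v)"
      using g[of v] by (intro unique) (simp add: blinfun.diff_right blinfun.scaleR_right)
    then show "S (g (r *\<^sub>R v)) = r *\<^sub>R S (g v)"
      by (simp add: blinfun.scaleR_right)
    obtain p where p: "T p = w" "norm p \<le> K * norm w" using K by blast
    \<comment> \<open>As \<open>C\<close> annihilates the range of \<open>1 - c C\<close>, the
      controlled preimage \<open>p\<close> also decomposes \<open>w\<close>, and its first entry
      bounds the projection.\<close>
    have "S (g w) = S (fst p)"
      using p(1) by (intro unique) (auto simp: T blinfun.diff_right blinfun.add_right CcC)
    also have "norm \<dots> \<le> norm S * norm (fst p)"
      by (rule norm_blinfun)
    also have "\<dots> \<le> norm S * (K * norm w)"
      using p(2) norm_fst_le[of "fst p" "snd p"] by (intro mult_left_mono) auto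
    finally show "norm (S (g w)) \<le> norm w * (norm S * K)"
      by (simp add: algebra_simps)
  qed
  then have "Blinfun (\<lambda>w. S (g w)) w = S (g w)" for w
    by (simp add: bounded_linear_Blinfun_apply)
  then show ?thesis
    using g by (intro exI[of _ "Blinfun (\<lambda>w. S (g w))"]) (simp add: op_range_def null_space_def)
qed

text \<open>For \<open>X = G P\<close>, with \<open>P\<close> the projection and \<open>G\<close>
  the inverse of the restriction, \<open>A X = P\<close> and \<open>X A B = B\<close>; these two
  identities determine the null space and the range and give \<open>X A X = X\<close>.\<close>

lemma outer_inverse_of_restriction_invertible:
  fixes s :: "'k::real_normed_field \<Rightarrow> 'a::banach \<Rightarrow> 'a" and A B C :: "'a \<Rightarrow>\<^sub>L 'a"
  assumes "normed_space_over s"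
    and A: "A \<in> operator_algebra s" and B: "B \<in> operator_algebra s"
    and C: "C \<in> operator_algebra s" and reg: "regular_in (operator_algebra s) C"
    and inv: "restriction_invertible s s A (op_range B) (op_range (A o\<^sub>L B))"
    and sum: "direct_sum_is_UNIV (op_range (A o\<^sub>L B)) (null_space C)"
  shows "\<exists>X\<in>operator_algebra s. X = X o\<^sub>L A o\<^sub>L X \<and>
    op_range X = op_range B \<and> null_space X = null_space C"
proof -
  interpret normed_space_over s by fact
  let ?M = "op_range (A o\<^sub>L B)" and ?N = "null_space C"
  have "A o\<^sub>L B \<in> operator_algebra s"
    using A B by (simp add: bounded_operators_def)
  then have M: "subspace ?M" by (rule subspace_op_range)
  have N: "subspace ?N" using C by (rule subspace_null_space)
  obtain P :: "'a \<Rightarrow>\<^sub>L 'a" where PM: "\<And>w. P w \<in> ?M" and PN: "\<And>w. w - P w \<in> ?N"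
    using reg bounded_projection_of_direct_sum[OF sum] unfolding regular_in_def by metis
  have unique: "P w = m" if "m \<in> ?M" "w - m \<in> ?N" for w m
  proof -
    have "P w - m \<in> ?M" using subspace_diff[OF M PM that(1)] .
    moreover have "(w - m) - (w - P w) \<in> ?N" using subspace_diff[OF N that(2) PN] .
    ultimately have "P w - m \<in> ?M \<inter> ?N" by simp
    then show ?thesis using sum unfolding direct_sum_is_UNIV_def by simp
  qed
  \<comment> \<open>A priori \<open>P\<close> is only real-linear. Homogeneity over
    \<open>'k\<close> holds because both summands are \<open>'k\<close>-subspaces and the
    decomposition is unique.\<close>
  have P_scale: "P (s r w) = s r (P w)" for r w
    using subspace_scale[OF M PM[of w], of r] subspace_scale[OF N PN[of w], of r]
    by (intro unique) (simp_all add: scale_right_diff_distrib)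
  obtain G K where G: "G ` ?M \<subseteq> op_range B"
    and G_add: "\<forall>x\<in>?M. \<forall>y\<in>?M. G (x + y) = G x + G y"
    and G_scale: "\<forall>c. \<forall>y\<in>?M. G (s c y) = s c (G y)"
    and K: "\<forall>y\<in>?M. norm (G y) \<le> K * norm y"
    and GA: "\<forall>x\<in>op_range B. G (A x) = x"
    and AG: "\<forall>y\<in>?M. A (G y) = y"
    using inv unfolding restriction_invertible_def by (elim conjE exE) (rule that)
  define X where "X = Blinfun (\<lambda>w. G (P w))"
  have "bounded_linear (\<lambda>w. G (P w))"
  proof (rule bounded_linear_intro)
    fix v w r
    show "G (P (v + w)) = G (P v) + G (P w)"
      by (simp add: blinfun.add_right G_add PM)
    show "G (P (r *\<^sub>R v)) = r *\<^sub>R G (P v)"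
      using bspec[OF spec[OF G_scale] PM, of "of_real r" v]
      by (simp add: blinfun.scaleR_right scale_of_real)
    \<comment> \<open>\<open>K\<close> may be negative if the range of \<open>A B\<close> is
      trivial, so its absolute value is used.\<close>
    have "norm (G (P w)) \<le> \<bar>K\<bar> * norm (P w)"
      using bspec[OF K PM, of w] abs_ge_self[of K] by (meson mult_right_mono norm_ge_zero order_trans)
    also have "\<dots> \<le> \<bar>K\<bar> * (norm P * norm w)"
      by (intro mult_left_mono norm_blinfun) simp
    finally show "norm (G (P w)) \<le> norm w * (\<bar>K\<bar> * norm P)"
      by (simp add: algebra_simps)
  qed
  then have X: "X w = G (P w)" for w
    by (simp add: X_def bounded_linear_Blinfun_apply)
  have AX: "A (X w) = P w" for w
    by (simp add: X AG PM)
  have XAB: "X (A (B z)) = B z" for z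
  proof -
    have "P (A (B z)) = A (B z)"
      using subspace_0[OF N] by (intro unique) (simp_all add: op_range_def range_eqI[of _ _ z])
    then show ?thesis by (simp add: X GA op_range_def)
  qed
  have R: "op_range X = op_range B"
  proof
    show "op_range X \<subseteq> op_range B"
      using G PM by (auto simp: op_range_def[of X] X)
    show "op_range B \<subseteq> op_range X"
      unfolding op_range_def by (metis XAB image_subsetI rangeI)
  qed
  have "X = X o\<^sub>L A o\<^sub>L X"
  proof (rule blinfun_eqI)
    fix w
    have "X w \<in> op_range B" using R by (auto simp: op_range_def)
    then obtain z where "X w = B z" by (auto simp: op_range_def)
    then show "X w = (X o\<^sub>L A o\<^sub>L X) w" by (simp add: XAB)
  qed
  moreover have "null_space X = ?N"
  proof -
    \<comment> \<open>One direction is \<open>A X = P\<close>; the other uses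
      \<open>G 0 = 0\<close>, read off from \<open>X 0 = 0\<close>.\<close>
    have "X w = 0 \<longleftrightarrow> P w = 0" for w
      using AX[of w] X[of w] X[of 0] by auto
    moreover have "P w = 0 \<longleftrightarrow> w \<in> ?N" for w
      using PN[of w] unique[of 0 w] subspace_0[OF M] by auto
    ultimately show ?thesis by (auto simp: null_space_def[of X])
  qed
  moreover have "X \<in> operator_algebra s"
    by (simp add: bounded_operators_def X P_scale G_scale PM)
  ultimately show ?thesis using R by blast
qed

section \<open>Equivalence of the four conditions and agreement of the inverses\<close>

theorem theorem3p5:
  fixes s :: "'k::real_normed_field \<Rightarrow> 'a::banach \<Rightarrow> 'a"
    and A B C :: "'a \<Rightarrow>\<^sub>L 'a"
  assumes "normed_space_over s"
    and "A \<in> operator_algebra s" and "B \<in> operator_algebra s" and "C \<in> operator_algebra s"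
    and "regular_in (operator_algebra s) B" and "regular_in (operator_algebra s) C"
  shows "(bc_invertible_in (operator_algebra s) B C A \<longleftrightarrow>
            (\<exists>X\<in>operator_algebra s. X = X o\<^sub>L A o\<^sub>L X \<and>
               op_range X = op_range B \<and> null_space X = null_space C))
       \<and> (bc_invertible_in (operator_algebra s) B C A \<longleftrightarrow>
            outer_inverse_exists s s A (op_range B) (null_space C))
       \<and> (bc_invertible_in (operator_algebra s) B C A \<longleftrightarrow>
            restriction_invertible s s A (op_range B) (op_range (A o\<^sub>L B)) \<and>
            direct_sum_is_UNIV (op_range (A o\<^sub>L B)) (null_space C))
       \<and> (bc_invertible_in (operator_algebra s) B C A \<longrightarrow>
            (\<forall>X\<in>operator_algebra s. X = X o\<^sub>L A o\<^sub>L X \<and>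
               op_range X = op_range B \<and> null_space X = null_space C \<longrightarrow>
               bc_inverse_in (operator_algebra s) B C A = X \<and>
               X = outer_inverse s s A (op_range B) (null_space C)))"
proof -
  interpret normed_space_over s by fact
  \<comment> \<open>Condition (ii) serves as the hub: for each single \<open>X\<close> it is
    equivalent to being the (B,C)-inverse and to being the outer inverse, so existence and equality
    both transfer.\<close>
  let ?out = "\<lambda>X. X \<in> operator_algebra s \<and> X = X o\<^sub>L A o\<^sub>L X \<and>
    op_range X = op_range B \<and> null_space X = null_space C"
  note bc = is_bc_inverse_in_iff_range_null_space[OF assms(5,6), of A]
  note outer = is_outer_inverse_range_null_space_iff[OF assms(3,4,5), of A]
  have iv: "(\<exists>X. ?out X) \<longleftrightarrow>
      restriction_invertible s s A (op_range B) (op_range (A o\<^sub>L B)) \<and>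
      direct_sum_is_UNIV (op_range (A o\<^sub>L B)) (null_space C)"
    using restriction_invertible_direct_sum_of_outer_inverse
      outer_inverse_of_restriction_invertible[OF assms(1-4,6)] by meson
  have "bc_inverse_in (operator_algebra s) B C A = X \<and>
      X = outer_inverse s s A (op_range B) (null_space C)" if "?out X" for X
  proof
    have "is_bc_inverse_in (operator_algebra s) B C A X"
      using that bc by blast
    then show "bc_inverse_in (operator_algebra s) B C A = X"
      unfolding bc_inverse_in_def by (intro the_equality is_bc_inverse_in_unique)
    have "is_outer_inverse s s A (op_range B) (null_space C) X"
      using that outer by blast
    then show "X = outer_inverse s s A (op_range B) (null_space C)"
      unfolding outer_inverse_def by (intro the_equality[symmetric] is_outer_inverse_unique)
  qed
  moreover have "bc_invertible_in (operator_algebra s) B C A \<longleftrightarrow> (\<exists>X. ?out X)"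
    unfolding bc_invertible_in_def using bc by blast
  moreover have "outer_inverse_exists s s A (op_range B) (null_space C) \<longleftrightarrow> (\<exists>X. ?out X)"
    unfolding outer_inverse_exists_def using outer by blast
  ultimately show ?thesis
    using iv unfolding Bex_def by blast
qed

end
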